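(* Let $0\le a,b\le 1$ and let $T=\begin{pmatrix} a & 1-b\\ 1-a & b\end{pmatrix}$. Then the distinguishability number satisfies $$\mathcal{M}(T)=\begin{cases}2 & \text{if } 0<|a-b|\le\tfrac12,\\ 3 & \text{if } a=b \text{ and } a\in\left[\tfrac13,\tfrac23\right]\setminus\left\{\tfrac12\right\},\\ 4 & \text{if } a=b=\tfrac12.\end{cases}$$
   Context: Fix an orthonormal basis of $\mathbb{C}^2$, whose vectors are denoted $|k\rangle$. A qubit quantum channel is a completely positive trace-preserving linear map $\Phi$ on $2\times2$ complex matrices. Its classical action is the (column-)stochastic $2\times 2$ matrix $T$ with $T_{kl}=\langle k|\Phi(|l\rangle\langle l|)|k\rangle$. A set of channels $\{\Phi^{(n)}\}_{n=1}^M$ is perfectly distinguishable if there is a (possibly entangled) pure bipartite state $|\Psi\rangle\in\mathbb{C}^2\otimes\mathbb{C}^2$ such that the output states $(\Phi^{(n)}\otimes\mathcal{I})(|\Psi\rangle\langle\Psi|)$, $n=1,\dots,M$, have pairwise orthogonal supports, where $\mathcal{I}$ is the identity channel. The distinguishability number $\mathcal{M}(T)$ is the maximal number of quantum channels that all have classical action $T$ and that are perfectly distinguishable. *)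

theory Defs
  imports "HOL-Analysis.Analysis" "HOL-Library.Extended_Nat"
begin

definition cinner :: "complex^'n \<Rightarrow> complex^'n \<Rightarrow> complex" where
  "cinner x y = (\<Sum>i\<in>UNIV. cnj (x $ i) * y $ i)"

definition orthonormal_basis :: "('n \<Rightarrow> complex^'n) \<Rightarrow> bool" where
  "orthonormal_basis e \<longleftrightarrow> (\<forall>k l. cinner (e k) (e l) = (if k = l then 1 else 0))"

definition ketbra :: "complex^'n \<Rightarrow> complex^'n^'n" where
  "ketbra x = (\<chi> i j. x $ i * cnj (x $ j))"

abbreviation mat_scale :: "complex \<Rightarrow> complex^'n^'n \<Rightarrow> complex^'n^'n" where
  "mat_scale c \<equiv> map_matrix ((*) c)"

text \<open>
  An operator on the tensor product of \<open>\<complex>\<^sup>n\<close> and \<open>\<complex>\<^sup>k\<close> is a \<open>k\<close> by \<open>k\<close> block matrix with blocks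
  in \<open>M\<^sub>n(\<complex>)\<close>, and the tensor product of a linear map \<open>\<Phi>\<close> with the identity applies \<open>\<Phi>\<close> to every
  block. Complete positivity quantifies over all \<open>k\<close>, so there the blocks are indexed by
  natural numbers below \<open>k\<close>; only those blocks and vectors matter.
\<close>

definition block_psd :: "nat \<Rightarrow> (nat \<Rightarrow> nat \<Rightarrow> complex^'n^'n) \<Rightarrow> bool" where
  "block_psd k X \<longleftrightarrow>
     (\<forall>v :: nat \<Rightarrow> complex^'n. (\<Sum>i<k. \<Sum>j<k. cinner (v i) (X i j *v v j)) \<in> \<real>\<^sub>\<ge>\<^sub>0)"

definition completely_positive :: "(complex^'n^'n \<Rightarrow> complex^'n^'n) \<Rightarrow> bool" where
  "completely_positive \<Phi> \<longleftrightarrow>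
     (\<forall>k X. block_psd k X \<longrightarrow> block_psd k (\<lambda>i j. \<Phi> (X i j)))"

definition quantum_channel :: "(complex^'n^'n \<Rightarrow> complex^'n^'n) \<Rightarrow> bool" where
  "quantum_channel \<Phi> \<longleftrightarrow>
     Vector_Spaces.linear mat_scale mat_scale \<Phi> \<and>
     completely_positive \<Phi> \<and>
     (\<forall>A. trace (\<Phi> A) = trace A)"

definition has_classical_action ::
    "('n \<Rightarrow> complex^'n) \<Rightarrow> (complex^'n^'n \<Rightarrow> complex^'n^'n) \<Rightarrow> real^'n^'n \<Rightarrow> bool" where
  "has_classical_action e \<Phi> T \<longleftrightarrow>
     (\<forall>k l. complex_of_real (T $ k $ l) = cinner (e k) (\<Phi> (ketbra (e l)) *v e k))"

text \<open>
  The map \<open>\<Phi> \<otimes> \<I>\<close> on operators on the bipartite space: the first component of an index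
  belongs to the system on which \<open>\<Phi>\<close> acts, the second one to the ancilla.
\<close>

definition tensor_id ::
    "(complex^'n^'n \<Rightarrow> complex^'n^'n) \<Rightarrow> complex^('n \<times> 'k::finite)^('n \<times> 'k) \<Rightarrow> complex^('n \<times> 'k)^('n \<times> 'k)" where
  "tensor_id \<Phi> X = (\<chi> p q. \<Phi> (\<chi> i j. X $ (i, snd p) $ (j, snd q)) $ fst p $ fst q)"

text \<open>The support of a Hermitian operator is the orthogonal complement of its kernel.\<close>

definition supp :: "complex^'n^'n \<Rightarrow> (complex^'n) set" where
  "supp \<rho> = {v. \<forall>w. \<rho> *v w = 0 \<longrightarrow> cinner w v = 0}"

definition orthogonal_supports :: "complex^'n^'n \<Rightarrow> complex^'n^'n \<Rightarrow> bool" where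
  "orthogonal_supports \<rho> \<sigma> \<longleftrightarrow> (\<forall>x\<in>supp \<rho>. \<forall>y\<in>supp \<sigma>. cinner x y = 0)"

definition perfectly_distinguishable :: "(complex^'n^'n \<Rightarrow> complex^'n^'n) set \<Rightarrow> bool" where
  "perfectly_distinguishable F \<longleftrightarrow>
     (\<exists>\<Psi> :: complex^('n \<times> 'n). norm \<Psi> = 1 \<and>
        pairwise (\<lambda>\<Phi> \<Theta>. orthogonal_supports (tensor_id \<Phi> (ketbra \<Psi>)) (tensor_id \<Theta> (ketbra \<Psi>))) F)"

text \<open>
  The supremum is taken in \<^typ>\<open>enat\<close>, so that no bound on the cardinalities is presupposed;
  whenever it is finite, it is attained.
\<close>

definition distinguishability_number :: "('n \<Rightarrow> complex^'n) \<Rightarrow> real^'n^'n \<Rightarrow> enat" where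
  "distinguishability_number e T =
     Sup {enat (card F) | F. finite F \<and> (\<forall>\<Phi>\<in>F. quantum_channel \<Phi> \<and> has_classical_action e \<Phi> T) \<and>
            perfectly_distinguishable F}"

end

theory Submission
  imports Defs
begin

text \<open>
  Upper bounds: the output states of distinguished channels on qubits have mutually orthogonal
  ranges in \<open>\<complex>\<^sup>4\<close>. Either the input vector \<open>\<Psi>\<close>, read as a matrix, is singular, so that all ranges lie
  in a common plane, or the rank of an output equals the Kraus rank of the channel. With three
  channels one of the outputs is then pure, hence that channel is unitary and \<open>T\<close> is bistochastic.
  With four channels all outputs are pure and sum to the identity, which forces
  \<open>\<Sum>\<^sub>n \<Phi>\<^sub>n(Y) = 2 tr(Y) 1\<close> and \<open>T\<^sub>k\<^sub>l = 1/2\<close>.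

  Lower bounds: a qubit unitary with bistochastic \<open>T\<close> is, up to phase, a unit vector
  \<open>(u, v) \<in> \<complex>\<^sup>2 = \<real>\<^sup>4\<close> with \<open>|u|\<^sup>2 = a\<close>, and the maximally entangled input distinguishes two of them
  iff the vectors are orthogonal in \<open>\<real>\<^sup>4\<close>. For \<open>a \<noteq> b\<close>, let a product input \<open>\<psi>\<close> be sent to
  \<open>(|0\<rangle> + |1\<rangle>)/\<surd>2\<close> by a non-unital channel; composing it with the phase flip keeps \<open>T\<close> and makes
  the output orthogonal.
\<close>

section \<open>Adjoints and complex inner products\<close>

definition adj :: "complex^'n^'m \<Rightarrow> complex^'m^'n" where
  "adj M = (\<chi> i j. cnj (M $ j $ i))"

lemma adj_nth [simp]: "adj M $ i $ j = cnj (M $ j $ i)"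
  by (simp add: adj_def)

lemma adj_adj [simp]: "adj (adj M) = M"
  by (simp add: vec_eq_iff)

lemma adj_mat_1 [simp]: "adj (mat 1) = mat 1"
  by (simp add: vec_eq_iff mat_def)

lemma matrix_add_rdistrib: "(A + B) ** C = A ** C + B ** (C :: complex^'n^'m)"
  by (simp add: vec_eq_iff matrix_matrix_mult_def sum.distrib distrib_right)

lemma adj_matrix_mul: "adj (A ** B) = adj B ** adj A"
  by (simp add: vec_eq_iff matrix_matrix_mult_def mult.commute)

lemma cinner_0_left [simp]: "cinner 0 y = 0"
  by (simp add: cinner_def)

lemma cinner_0_right [simp]: "cinner x 0 = 0"
  by (simp add: cinner_def)

lemma cinner_add_left: "cinner (x + y) z = cinner x z + cinner y z"
  by (simp add: cinner_def sum.distrib algebra_simps)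

lemma cinner_add_right: "cinner x (y + z) = cinner x y + cinner x z"
  by (simp add: cinner_def sum.distrib algebra_simps)

lemma cinner_diff_right: "cinner x (y - z) = cinner x y - cinner x z"
  by (simp add: cinner_def sum_subtractf algebra_simps)

lemma cinner_scale_left: "cinner (c *s x) y = cnj c * cinner x y"
  by (simp add: cinner_def sum_distrib_left algebra_simps)

lemma cinner_scale_right: "cinner x (c *s y) = c * cinner x y"
  by (simp add: cinner_def sum_distrib_left algebra_simps)

lemma cinner_sum_right: "cinner x (\<Sum>i\<in>I. f i) = (\<Sum>i\<in>I. cinner x (f i))"
  by (induction I rule: infinite_finite_induct) (simp_all add: cinner_add_right)

lemma cnj_cinner [simp]: "cnj (cinner x y) = cinner y x"
  by (simp add: cinner_def mult.commute)

lemma cinner_eq_0_sym: "cinner x y = 0 \<longleftrightarrow> cinner y x = 0"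
  by (metis cnj_cinner complex_cnj_zero)

lemma cinner_self: "cinner x x = complex_of_real ((norm x)\<^sup>2)"
proof -
  have "cinner x x = (\<Sum>i\<in>UNIV. complex_of_real ((norm (x $ i))\<^sup>2))"
    unfolding cinner_def by (rule sum.cong) (simp_all only: mult.commute complex_norm_square)
  then show ?thesis
    by (simp add: norm_vec_def L2_set_def sum_nonneg)
qed

lemma cinner_self_eq_0 [simp]: "cinner x x = 0 \<longleftrightarrow> x = 0"
  by (simp add: cinner_self)

lemma matrix_vector_mult_sum_left: "(\<Sum>i\<in>I. M i) *v x = (\<Sum>i\<in>I. M i *v x)"
  by (induction I rule: infinite_finite_induct) (simp_all add: matrix_vector_mult_add_rdistrib)

lemma cinner_matrix_vector: "cinner x (M *v y) = cinner (adj M *v x) y"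
proof -
  have "cinner x (M *v y) = (\<Sum>i\<in>UNIV. \<Sum>j\<in>UNIV. cnj (x $ i) * (M $ i $ j * y $ j))"
    by (simp add: cinner_def matrix_vector_mult_def sum_distrib_left)
  also have "\<dots> = (\<Sum>j\<in>UNIV. \<Sum>i\<in>UNIV. cnj (x $ i) * (M $ i $ j * y $ j))"
    by (rule sum.swap)
  also have "\<dots> = cinner (adj M *v x) y"
    by (simp add: cinner_def matrix_vector_mult_def sum_distrib_left sum_distrib_right mult_ac)
  finally show ?thesis .
qed

lemma cinner_matrix_vector_axis: "cinner (axis i 1) (M *v axis j 1) = M $ i $ j"
  by (simp add: cinner_def matrix_vector_mult_def axis_def if_distrib if_distribR cong: if_cong)

lemma ketbra_nth [simp]: "ketbra x $ i $ j = x $ i * cnj (x $ j)"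
  by (simp add: ketbra_def)

lemma ketbra_mult_vector: "ketbra x *v y = cinner x y *s x"
  by (simp add: vec_eq_iff matrix_vector_mult_def cinner_def sum_distrib_left sum_distrib_right mult_ac)

lemma adj_ketbra [simp]: "adj (ketbra x) = ketbra x"
  by (simp add: vec_eq_iff)

lemma trace_ketbra: "trace (ketbra x) = cinner x x"
  by (simp add: trace_def cinner_def mult.commute)

lemma matrix_ketbra_adj: "M ** ketbra x ** adj M = ketbra (M *v x)"
  by (simp add: vec_eq_iff matrix_matrix_mult_def matrix_vector_mult_def
      sum_distrib_left sum_distrib_right mult_ac)

lemma mat_mult_vector: "mat c *v x = c *s x"
  by (simp add: vec_eq_iff matrix_vector_mult_def mat_def if_distrib if_distribR cong: if_cong)

section \<open>Orthogonality counts and Hermitian matrices\<close>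

lemma orthogonal_family_card_le:
  fixes x :: "'i \<Rightarrow> complex^'n"
  assumes "finite I" and nz: "\<And>i. i \<in> I \<Longrightarrow> x i \<noteq> 0"
    and orth: "\<And>i j. i \<in> I \<Longrightarrow> j \<in> I \<Longrightarrow> i \<noteq> j \<Longrightarrow> cinner (x i) (x j) = 0"
  shows "card I \<le> CARD('n)"
proof -
  have inj: "inj_on x I"
    using nz orth by (metis cinner_self_eq_0 inj_onI)
  have "vec.independent (x ` I)"
  proof (rule vec.independent_if_scalars_zero)
    fix f v assume 0: "(\<Sum>v\<in>x ` I. f v *s v) = 0" and "v \<in> x ` I"
    then obtain i where i: "i \<in> I" "v = x i" by auto
    have "0 = cinner (x i) (\<Sum>j\<in>I. f (x j) *s x j)"
      using 0 by (simp add: sum.reindex[OF inj])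
    also have "\<dots> = (\<Sum>j\<in>I. if j = i then f (x j) * cinner (x j) (x j) else 0)"
      unfolding cinner_sum_right cinner_scale_right
      by (rule sum.cong) (use orth i in auto)
    finally show "f v = 0"
      using i nz \<open>finite I\<close> by auto
  qed (use assms in simp)
  then have "card (x ` I) \<le> vec.dim (UNIV :: (complex^'n) set)"
    by (intro vec.independent_card_le_dim) auto
  then show ?thesis
    by (simp add: card_image[OF inj] vec.dim_UNIV card_cart_basis)
qed

text \<open>Polarization: the test vector x + y forces the imaginary part of
  \<open>M $ i $ j + M $ j $ i\<close> to vanish, and x + iy the real part of
  \<open>M $ i $ j - M $ j $ i\<close>.\<close>

lemma real_form_imp_adj_eq:
  fixes M :: "complex^'n^'n"
  assumes "\<And>v. cinner v (M *v v) \<in> \<real>"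
  shows "adj M = M"
proof -
  have "cnj (M $ j $ i) = M $ i $ j" for i j
  proof -
    let ?x = "axis i 1 :: complex^'n" and ?y = "axis j 1 :: complex^'n"
    have exp: "cinner (?x + c *s ?y) (M *v (?x + c *s ?y))
        = M $ i $ i + c * M $ i $ j + cnj c * M $ j $ i + cnj c * c * M $ j $ j" for c
      by (simp add: cinner_add_left cinner_add_right cinner_scale_left cinner_scale_right
          matrix_vector_right_distrib vec.scale cinner_matrix_vector_axis algebra_simps)
    have "cinner ?x (M *v ?x) \<in> \<real>" "cinner ?y (M *v ?y) \<in> \<real>"
      using assms by blast+
    moreover have "cinner (?x + 1 *s ?y) (M *v (?x + 1 *s ?y)) \<in> \<real>"
      "cinner (?x + \<i> *s ?y) (M *v (?x + \<i> *s ?y)) \<in> \<real>"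
      using assms by blast+
    ultimately show ?thesis
      unfolding exp cinner_matrix_vector_axis by (auto simp: complex_is_Real_iff complex_eq_iff)
  qed
  then show ?thesis by (simp add: vec_eq_iff)
qed

text \<open>Take a unit vector w in the range. If the range is the line through w, Hermiticity makes
  \<rho> a multiple of \<open>ketbra w\<close> and the trace fixes the factor 1. Otherwise one
  Gram-Schmidt step inside the range yields a vector orthogonal to w.\<close>

lemma hermitian_rank_one_or_orthogonal_range:
  fixes \<rho> :: "complex^'n^'n"
  assumes herm: "adj \<rho> = \<rho>" and tr: "trace \<rho> = 1"
  shows "(\<exists>w. cinner w w = 1 \<and> \<rho> = ketbra w) \<or>
    (\<exists>x y. \<rho> *v x \<noteq> 0 \<and> \<rho> *v y \<noteq> 0 \<and> cinner (\<rho> *v x) (\<rho> *v y) = 0)"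
proof -
  have "\<exists>u. \<rho> *v u \<noteq> 0"
    by (metis matrix_eq matrix_vector_mult_0 tr trace_0 mat_0 zero_neq_one)
  then obtain u where u: "\<rho> *v u \<noteq> 0" by blast
  define v where "v = complex_of_real (1 / norm (\<rho> *v u)) *s u"
  define w where "w = \<rho> *v v"
  have "w = complex_of_real (1 / norm (\<rho> *v u)) *s (\<rho> *v u)"
    unfolding w_def v_def vec.scale ..
  then have "cinner w w = cnj (1 / norm (\<rho> *v u)) * (1 / norm (\<rho> *v u) * cinner (\<rho> *v u) (\<rho> *v u))"
    by (metis cinner_scale_left cinner_scale_right mult.left_commute of_real_1)
  also have "\<dots> = complex_of_real ((1 / norm (\<rho> *v u)) * (1 / norm (\<rho> *v u)) * (norm (\<rho> *v u))\<^sup>2)"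
    by (simp add: cinner_self)
  also have "\<dots> = 1"
    using u by (simp add: power2_eq_square)
  finally have ww: "cinner w w = 1" .
  show ?thesis
  proof (cases "\<forall>x. \<rho> *v x = cinner w (\<rho> *v x) *s w")
    case True
    define c where "c = cinner (\<rho> *v w) w"
    have "\<rho> *v x = cinner (\<rho> *v w) x *s w" for x
      using True by (metis cinner_matrix_vector herm)
    moreover have "\<rho> *v w = cnj c *s w"
      using True by (metis c_def cnj_cinner)
    ultimately have *: "\<rho> *v x = c *s (ketbra w *v x)" for x
      by (simp add: ketbra_mult_vector cinner_scale_left)
    then have \<rho>: "\<rho> = map_matrix ((*) c) (ketbra w)"
      unfolding matrix_eq
      by (auto simp: vec_eq_iff matrix_vector_mult_def sum_distrib_left mult_ac)
    have "trace \<rho> = c * trace (ketbra w)"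
      by (simp add: \<rho> trace_def sum_distrib_left)
    with tr ww have "c = 1" by (simp add: trace_ketbra)
    then show ?thesis using \<rho> ww by (auto simp: vec_eq_iff)
  next
    case False
    then obtain x where x: "\<rho> *v x \<noteq> cinner w (\<rho> *v x) *s w" by blast
    define y where "y = x - cinner w (\<rho> *v x) *s v"
    have y: "\<rho> *v y = \<rho> *v x - cinner w (\<rho> *v x) *s w"
      unfolding y_def w_def matrix_vector_mult_diff_distrib vec.scale ..
    have "cinner (\<rho> *v v) (\<rho> *v y) = 0"
      unfolding y w_def[symmetric] by (simp add: cinner_diff_right cinner_scale_right ww)
    moreover have "\<rho> *v v \<noteq> 0" using ww w_def by fastforce
    moreover have "\<rho> *v y \<noteq> 0" using x y by simp
    ultimately show ?thesis by blast
  qed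
qed

text \<open>The product condition puts the range of \<rho> into the kernel of \<sigma>, so the
  support of \<sigma> is orthogonal to that range and, by Hermiticity, lies in the kernel of
  \<rho>.\<close>

lemma orthogonal_supportsI:
  assumes "adj \<rho> = \<rho>" and "\<sigma> ** \<rho> = 0"
  shows "orthogonal_supports \<rho> \<sigma>"
  unfolding orthogonal_supports_def
proof (intro ballI)
  fix x y assume x: "x \<in> supp \<rho>" and y: "y \<in> supp \<sigma>"
  have "cinner (\<rho> *v w) y = 0" for w
    using y assms(2) by (auto simp: supp_def matrix_vector_mul_assoc)
  then have "cinner w (\<rho> *v y) = 0" for w
    by (metis assms(1) cinner_matrix_vector)
  then have "\<rho> *v y = 0" by (metis cinner_self_eq_0)
  then show "cinner x y = 0"
    using x cinner_eq_0_sym[of x y] by (auto simp: supp_def)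
qed

lemma orthogonal_supports_range:
  assumes "orthogonal_supports \<rho> \<sigma>" and "adj \<rho> = \<rho>" and "adj \<sigma> = \<sigma>"
  shows "cinner (\<rho> *v x) (\<sigma> *v y) = 0"
proof -
  have "\<rho> *v x \<in> supp \<rho>" "\<sigma> *v y \<in> supp \<sigma>"
    using assms by (auto simp: supp_def cinner_matrix_vector)
  then show ?thesis using assms(1) by (auto simp: orthogonal_supports_def)
qed

section \<open>Output states and upper bounds\<close>

text \<open>If \<open>A\<close> is the input matrix of \<open>\<Psi>\<close>, then \<open>\<Psi> = (A \<otimes> 1)(\<Sum>\<^sub>j |j\<rangle>|j\<rangle>)\<close>.\<close>

definition input_matrix :: "complex^('n::finite \<times> 'k::finite) \<Rightarrow> complex^'k^'n" where
  "input_matrix \<Psi> = (\<chi> i j. \<Psi> $ (i, j))"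

lemma sum_prod_UNIV: "(\<Sum>p\<in>UNIV. f p) = (\<Sum>j\<in>UNIV. \<Sum>i\<in>UNIV. f (i, j))"
  by (subst sum.swap) (simp add: sum.cartesian_product flip: UNIV_Times_UNIV)

lemma conj_input_matrix_nth:
  fixes \<Psi> :: "complex^('n::finite \<times> 'k::finite)"
  shows "(input_matrix \<Psi> ** M ** adj (input_matrix \<Psi>)) $ i $ i' =
    (\<Sum>j\<in>UNIV. \<Sum>j'\<in>UNIV. M $ j $ j' * (\<Psi> $ (i, j) * cnj (\<Psi> $ (i', j'))))"
  by (subst sum.swap) (simp add: matrix_matrix_mult_def input_matrix_def sum_distrib_left mult_ac)

text \<open>Bridge between a channel and its output: A M A* is the combination of the blocks of
  \<open>ketbra \<Psi>\<close> with coefficients M, so linearity suffices. An invertible A makes the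
  output determine \<Phi>; a singular A, with M chosen so that A M = 0, yields linear relations on
  the output.\<close>

lemma channel_conj_input_matrix:
  fixes \<Psi> :: "complex^('n::finite \<times> 'k::finite)"
  assumes "Vector_Spaces.linear mat_scale mat_scale \<Phi>"
  shows "\<Phi> (input_matrix \<Psi> ** M ** adj (input_matrix \<Psi>)) $ k $ k' =
    (\<Sum>j\<in>UNIV. \<Sum>j'\<in>UNIV. M $ j $ j' * tensor_id \<Phi> (ketbra \<Psi>) $ (k, j) $ (k', j'))"
proof -
  interpret Vector_Spaces.linear mat_scale mat_scale \<Phi> by fact
  have "input_matrix \<Psi> ** M ** adj (input_matrix \<Psi>) = (\<Sum>j\<in>UNIV. \<Sum>j'\<in>UNIV.
      mat_scale (M $ j $ j') (\<chi> i i'. ketbra \<Psi> $ (i, j) $ (i', j')))"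
    by (simp add: vec_eq_iff conj_input_matrix_nth)
  then show ?thesis
    by (simp add: sum scale tensor_id_def)
qed

text \<open>The form collapses to the squared modulus of a single sum \<open>S\<close>. This is the
  positivity of a pure state, the input to which complete positivity is applied.\<close>

lemma block_psd_outer:
  fixes x :: "nat \<Rightarrow> complex^'n"
  shows   "block_psd k (\<lambda>a b. \<chi> i i'. x a $ i * cnj (x b $ i'))"
  unfolding block_psd_def
proof
  fix v :: "nat \<Rightarrow> complex^'n"
  define S where "S = (\<Sum>a<k. cinner (x a) (v a))"
  have "cinner (v a) ((\<chi> i i'. x a $ i * cnj (x b $ i')) *v v b) = cinner (v a) (x a) * cinner (x b) (v b)" for a b
  proof -
    have "(\<chi> i i'. x a $ i * cnj (x b $ i')) *v v b = cinner (x b) (v b) *s x a"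
      by (simp add: vec_eq_iff matrix_vector_mult_def cinner_def sum_distrib_left mult_ac)
    then show ?thesis by (simp add: cinner_scale_right)
  qed
  then have "(\<Sum>a<k. \<Sum>b<k. cinner (v a) ((\<chi> i i'. x a $ i * cnj (x b $ i')) *v v b)) = cnj S * S"
    by (simp add: S_def sum_product)
  also have "\<dots> = complex_of_real ((norm S)\<^sup>2)"
    by (simp only: mult.commute complex_norm_square)
  finally show "(\<Sum>a<k. \<Sum>b<k. cinner (v a) ((\<chi> i i'. x a $ i * cnj (x b $ i')) *v v b)) \<in> \<real>\<^sub>\<ge>\<^sub>0"
    by simp
qed

lemma adj_channel_output:
  fixes \<Psi> :: "complex^('n::finite \<times> 'k::finite)"
  assumes "completely_positive \<Phi>"
  shows "adj (tensor_id \<Phi> (ketbra \<Psi>)) = tensor_id \<Phi> (ketbra \<Psi>)"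
proof (rule real_form_imp_adj_eq)
  fix V :: "complex^('n \<times> 'k)"
  let ?n = "CARD('k)"
  \<comment> \<open>Complete positivity indexes blocks by naturals below k, while the ancilla is
    indexed by a finite type; an enumeration translates the double sum.\<close>
  obtain idx :: "nat \<Rightarrow> 'k" where "bij_betw idx {0..<?n} UNIV"
    using ex_bij_betw_nat_finite[of "UNIV :: 'k set"] by auto
  then have idx: "bij_betw idx {..<?n} UNIV"
    by (simp add: lessThan_atLeast0)
  let ?X = "\<lambda>j j'. \<chi> i i'. ketbra \<Psi> $ (i, j) $ (i', j')"
  let ?v = "\<lambda>j. \<chi> i. V $ (i, j)"
  have "block_psd ?n (\<lambda>a b. ?X (idx a) (idx b))"
    using block_psd_outer[of ?n "\<lambda>a. \<chi> i. \<Psi> $ (i, idx a)"] by simp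
  then have "block_psd ?n (\<lambda>a b. \<Phi> (?X (idx a) (idx b)))"
    using assms unfolding completely_positive_def by blast
  then have "(\<Sum>a<?n. \<Sum>b<?n. cinner (?v (idx a)) (\<Phi> (?X (idx a) (idx b)) *v ?v (idx b))) \<in> \<real>\<^sub>\<ge>\<^sub>0"
    unfolding block_psd_def by (rule spec)
  also have "(\<Sum>a<?n. \<Sum>b<?n. cinner (?v (idx a)) (\<Phi> (?X (idx a) (idx b)) *v ?v (idx b)))
      = (\<Sum>a<?n. \<Sum>j'\<in>UNIV. cinner (?v (idx a)) (\<Phi> (?X (idx a) j') *v ?v j'))"
    by (intro sum.cong refl sum.reindex_bij_betw[OF idx])
  also have "\<dots> = (\<Sum>j\<in>UNIV. \<Sum>j'\<in>UNIV. cinner (?v j) (\<Phi> (?X j j') *v ?v j'))"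
    by (rule sum.reindex_bij_betw[OF idx])
  also have "\<dots> = cinner V (tensor_id \<Phi> (ketbra \<Psi>) *v V)"
  proof -
    have "(\<Sum>j'\<in>UNIV. cinner (?v j) (\<Phi> (?X j j') *v ?v j')) =
        (\<Sum>i\<in>UNIV. cnj (V $ (i, j)) * (tensor_id \<Phi> (ketbra \<Psi>) *v V) $ (i, j))" for j
      unfolding cinner_def
      by (subst sum.swap) (simp add: matrix_vector_mult_def sum_prod_UNIV tensor_id_def sum_distrib_left)
    then show ?thesis
      by (simp add: cinner_def[of V] sum_prod_UNIV)
  qed
  finally show "cinner V (tensor_id \<Phi> (ketbra \<Psi>) *v V) \<in> \<real>"
    using nonneg_Reals_subset_Reals by blast
qed

lemma trace_channel_output:
  fixes \<Psi> :: "complex^('n::finite \<times> 'k::finite)"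
  assumes "\<And>A. trace (\<Phi> A) = trace A" and "norm \<Psi> = 1"
  shows "trace (tensor_id \<Phi> (ketbra \<Psi>)) = 1"
proof -
  have "trace (tensor_id \<Phi> (ketbra \<Psi>)) =
      (\<Sum>j\<in>UNIV. trace (\<Phi> (\<chi> i i'. ketbra \<Psi> $ (i, j) $ (i', j))))"
    by (simp add: trace_def sum_prod_UNIV tensor_id_def)
  also have "\<dots> = trace (ketbra \<Psi>)"
    unfolding assms(1) by (simp add: trace_def sum_prod_UNIV)
  also have "\<dots> = 1"
    using assms(2) by (simp add: trace_ketbra cinner_self)
  finally show ?thesis .
qed

section \<open>From pure outputs to unital channels\<close>

lemma trace_mult_eq_trace_imp_mat_1:
  fixes N :: "complex^'n^'n"
  assumes "\<And>Y. trace (N ** Y) = trace Y"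
  shows "N = mat 1"
  unfolding vec_eq_iff
proof (intro allI)
  fix i j
  \<comment> \<open>The matrix unit at position (j, i) extracts the entry (i, j) of \<open>N\<close>
    from the trace.\<close>
  let ?Y = "(\<chi> r c. if r = j \<and> c = i then 1 else 0) :: complex^'n^'n"
  have "(N ** ?Y) $ r $ r = (if r = i then N $ i $ j else 0)" for r
    by (simp add: matrix_matrix_mult_def if_distrib cong: if_cong)
  then have "trace (N ** ?Y) = N $ i $ j"
    by (simp add: trace_def)
  moreover have "trace ?Y = (if i = j then 1 else 0)"
    by (auto simp: trace_def intro!: sum.neutral)
  ultimately show "N $ i $ j = mat 1 $ i $ j"
    using assms by (simp add: mat_def)
qed

text \<open>The matrix with columns \<open>e k\<close> has a left inverse, its adjoint; being
  square, it also has it as right inverse, which is the resolution of the identity.\<close>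

lemma sum_ketbra_orthonormal_basis:
  assumes "orthonormal_basis e"
  shows "(\<Sum>l\<in>UNIV. ketbra (e l)) = mat 1"
proof -
  define E where "E = (\<chi> i k. e k $ i)"
  have "adj E ** E = mat 1"
    using assms by (simp add: E_def vec_eq_iff matrix_matrix_mult_def mat_def
        orthonormal_basis_def cinner_def)
  then have "E ** adj E = mat 1"
    by (simp add: matrix_left_right_inverse)
  then show ?thesis
    by (simp add: E_def vec_eq_iff matrix_matrix_mult_def)
qed

lemma unital_classical_action:
  fixes \<Phi> :: "complex^'n^'n \<Rightarrow> complex^'n^'n"
  assumes e: "orthonormal_basis e" and lin: "Vector_Spaces.linear mat_scale mat_scale \<Phi>"
    and T: "has_classical_action e \<Phi> T" and unital: "\<Phi> (mat 1) = mat 1"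
  shows "(\<Sum>l\<in>UNIV. T $ k $ l) = 1"
proof -
  interpret Vector_Spaces.linear mat_scale mat_scale \<Phi> by fact
  have "complex_of_real (\<Sum>l\<in>UNIV. T $ k $ l) = (\<Sum>l\<in>UNIV. cinner (e k) (\<Phi> (ketbra (e l)) *v e k))"
    using T by (simp add: has_classical_action_def)
  also have "\<dots> = cinner (e k) ((\<Sum>l\<in>UNIV. \<Phi> (ketbra (e l))) *v e k)"
    by (simp add: matrix_vector_mult_sum_left cinner_sum_right)
  also have "(\<Sum>l\<in>UNIV. \<Phi> (ketbra (e l))) = mat 1"
    using unital sum_ketbra_orthonormal_basis[OF e] by (simp flip: sum)
  also have "cinner (e k) (mat 1 *v e k) = 1"
    using e by (simp add: orthonormal_basis_def)
  finally show ?thesis using of_real_eq_1_iff by blast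
qed

text \<open>With an invertible input, a pure output leaves a single Kraus operator \<open>K\<close>.
  Trace preservation makes \<open>K\<close> an isometry, and a square isometry is unitary.\<close>

lemma pure_output_unital:
  fixes \<Psi> :: "complex^('n::finite \<times> 'n)"
  assumes lin: "Vector_Spaces.linear mat_scale mat_scale \<Phi>"
    and tp: "\<And>A. trace (\<Phi> A) = trace A"
    and pure: "tensor_id \<Phi> (ketbra \<Psi>) = ketbra w"
    and B: "B ** input_matrix \<Psi> = mat 1"
  shows "\<Phi> (mat 1) = mat 1"
proof -
  define K where "K = input_matrix w ** B"
  have \<Phi>: "\<Phi> Y = K ** Y ** adj K" for Y
  proof -
    have AB: "input_matrix \<Psi> ** B = mat 1"
      using B by (simp add: matrix_left_right_inverse)
    then have BA: "adj B ** adj (input_matrix \<Psi>) = mat 1"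
      by (simp flip: adj_matrix_mul)
    \<comment> \<open>Chosen so that conjugation with the input matrix returns \<open>Y\<close>; the
      channel can then be read off from its output.\<close>
    let ?M = "B ** Y ** adj B"
    have "input_matrix \<Psi> ** ?M ** adj (input_matrix \<Psi>) =
        (input_matrix \<Psi> ** B) ** Y ** (adj B ** adj (input_matrix \<Psi>))"
      by (simp only: matrix_mul_assoc)
    then have Y: "input_matrix \<Psi> ** ?M ** adj (input_matrix \<Psi>) = Y"
      by (simp add: AB BA)
    have "\<Phi> Y $ k $ k' = (input_matrix w ** ?M ** adj (input_matrix w)) $ k $ k'" for k k'
      using channel_conj_input_matrix[OF lin, of \<Psi> ?M k k']
      unfolding Y pure conj_input_matrix_nth[of w] by simp
    then have "\<Phi> Y = input_matrix w ** ?M ** adj (input_matrix w)"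
      by (simp add: vec_eq_iff)
    then show ?thesis
      by (simp add: K_def adj_matrix_mul matrix_mul_assoc)
  qed
  have "trace (adj K ** K ** Y) = trace Y" for Y
    using tp[of Y] trace_mul_sym[of "K ** Y" "adj K"] by (simp add: \<Phi> matrix_mul_assoc)
  then have "adj K ** K = mat 1"
    by (rule trace_mult_eq_trace_imp_mat_1)
  then show ?thesis
    by (simp add: \<Phi> matrix_left_right_inverse)
qed

section \<open>Dimension counts for a family of discriminated channels\<close>

locale discriminated_channels =
  fixes F :: "(complex^'n^'n \<Rightarrow> complex^'n^'n) set" and \<Psi> :: "complex^('n \<times> 'n)"
  assumes fin: "finite F"
    and channel: "\<Phi> \<in> F \<Longrightarrow> quantum_channel \<Phi>"
    and norm_input: "norm \<Psi> = 1"
    and orthogonal: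
      "pairwise (\<lambda>\<Phi> \<Theta>. orthogonal_supports (tensor_id \<Phi> (ketbra \<Psi>)) (tensor_id \<Theta> (ketbra \<Psi>))) F"
begin

abbreviation out_state where "out_state \<Phi> \<equiv> tensor_id \<Phi> (ketbra \<Psi>)"

lemma channel_linear: "\<Phi> \<in> F \<Longrightarrow> Vector_Spaces.linear mat_scale mat_scale \<Phi>"
  using channel by (simp add: quantum_channel_def)

lemma channel_trace: "\<Phi> \<in> F \<Longrightarrow> trace (\<Phi> A) = trace A"
  using channel by (simp add: quantum_channel_def)

lemma adj_output: "\<Phi> \<in> F \<Longrightarrow> adj (out_state \<Phi>) = out_state \<Phi>"
  using channel by (simp add: quantum_channel_def adj_channel_output)

lemma trace_output: "\<Phi> \<in> F \<Longrightarrow> trace (out_state \<Phi>) = 1"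
  using trace_channel_output channel_trace norm_input by blast

lemma output_range_orthogonal:
  "\<Phi> \<in> F \<Longrightarrow> \<Theta> \<in> F \<Longrightarrow> \<Phi> \<noteq> \<Theta> \<Longrightarrow> cinner (out_state \<Phi> *v x) (out_state \<Theta> *v y) = 0"
  using orthogonal adj_output by (auto simp: pairwise_def intro!: orthogonal_supports_range)

lemma output_nonzero:
  assumes "\<Phi> \<in> F"
  shows "\<exists>x. out_state \<Phi> *v x \<noteq> 0"
  using trace_output[OF assms] by (metis matrix_eq matrix_vector_mult_0 trace_0 mat_0 zero_neq_one)

lemma output_cases:
  assumes "\<Phi> \<in> F"
  obtains (pure) w where "cinner w w = 1" "out_state \<Phi> = ketbra w"
  | (mixed) x y where "out_state \<Phi> *v x \<noteq> 0" "out_state \<Phi> *v y \<noteq> 0"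
      "cinner (out_state \<Phi> *v x) (out_state \<Phi> *v y) = 0"
  using hermitian_rank_one_or_orthogonal_range adj_output trace_output assms by meson

text \<open>Each channel contributes one vector of its output range, and the \<open>z i\<close>
  occupy further orthogonal directions of the bipartite space. The bounds below come from exhibiting
  such spare directions.\<close>

lemma card_plus_le:
  fixes z :: "'i \<Rightarrow> complex^('n \<times> 'n)"
  assumes "finite I" and nz: "\<And>i. i \<in> I \<Longrightarrow> z i \<noteq> 0"
    and orth: "\<And>i j. i \<in> I \<Longrightarrow> j \<in> I \<Longrightarrow> i \<noteq> j \<Longrightarrow> cinner (z i) (z j) = 0"
    and range: "\<And>\<Phi>. \<Phi> \<in> F \<Longrightarrow> \<exists>x. out_state \<Phi> *v x \<noteq> 0 \<and> (\<forall>i\<in>I. cinner (z i) (out_state \<Phi> *v x) = 0)"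
  shows "card F + card I \<le> CARD('n)\<^sup>2"
proof -
  obtain x where x: "\<And>\<Phi>. \<Phi> \<in> F \<Longrightarrow> out_state \<Phi> *v x \<Phi> \<noteq> 0"
      "\<And>\<Phi> i. \<Phi> \<in> F \<Longrightarrow> i \<in> I \<Longrightarrow> cinner (z i) (out_state \<Phi> *v x \<Phi>) = 0"
    using range by metis
  then have x': "cinner (out_state \<Phi> *v x \<Phi>) (z i) = 0" if "\<Phi> \<in> F" "i \<in> I" for \<Phi> i
    using that cinner_eq_0_sym by blast
  have "card (F <+> I) \<le> CARD('n \<times> 'n)"
  proof (rule orthogonal_family_card_le[where x = "case_sum (\<lambda>\<Phi>. out_state \<Phi> *v x \<Phi>) z"])
    fix i j assume "i \<in> F <+> I" "j \<in> F <+> I" "i \<noteq> j"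
    then show "cinner (case_sum (\<lambda>\<Phi>. out_state \<Phi> *v x \<Phi>) z i)
        (case_sum (\<lambda>\<Phi>. out_state \<Phi> *v x \<Phi>) z j) = 0"
      by (elim PlusE) (use orth x x' output_range_orthogonal in simp_all)
  qed (use fin assms(1) nz x in auto)
  then show ?thesis
    using fin assms(1) by (simp add: card_Plus power2_eq_square)
qed

lemma card_le: "card F \<le> CARD('n)\<^sup>2"
  using card_plus_le[of "{} :: nat set"] output_nonzero by simp

text \<open>A kernel vector c of the input matrix marks an ancilla direction that the input never
  populates and that no channel acting on the other factor can reach; this costs one dimension for
  each basis vector of the system.\<close>

lemma singular_input_card:
  assumes "input_matrix \<Psi> *v c = 0" and "c \<noteq> 0"
  shows "card F + CARD('n) \<le> CARD('n)\<^sup>2"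
proof -
  \<comment> \<open>\<open>n\<close> vectors orthogonal to every output range\<close>
  define z where "z k = (\<chi> p. if fst p = k then cnj (c $ snd p) else 0)" for k :: 'n
  have zz: "cinner (z k) v = (\<Sum>j\<in>UNIV. c $ j * v $ (k, j))" for k v
    by (simp add: z_def cinner_def sum_prod_UNIV if_distrib if_distribR cong: if_cong)
  have z0: "z k \<noteq> 0" for k
    using assms(2) by (auto simp: z_def vec_eq_iff)
  have z1: "cinner (z k) (z k') = 0" if "k \<noteq> k'" for k k'
    unfolding zz using that by (simp add: z_def)
  have z2: "cinner (z k) (out_state \<Phi> *v x) = 0" if "\<Phi> \<in> F" for \<Phi> k x
  proof -
    interpret Vector_Spaces.linear mat_scale mat_scale \<Phi>
      by (rule channel_linear[OF that])
    have "(\<Sum>j\<in>UNIV. c $ j * out_state \<Phi> $ (k, j) $ (k', j0)) = 0" for k' j0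
    proof -
      \<comment> \<open>Only column \<open>j0\<close> is nonzero and equals c, so A M = 0. Linearity
        sends this to 0, and the bridge identity isolates the contraction of one output column with
        c.\<close>
      define M :: "complex^'n^'n" where "M = (\<chi> j j'. if j' = j0 then c $ j else 0)"
      have "(input_matrix \<Psi> ** M) $ i $ j' = (if j' = j0 then (input_matrix \<Psi> *v c) $ i else 0)" for i j'
        by (cases "j' = j0") (simp_all add: M_def matrix_matrix_mult_def matrix_vector_mult_def)
      then have "input_matrix \<Psi> ** M = 0"
        by (simp add: vec_eq_iff assms(1))
      then have "(\<Sum>j\<in>UNIV. \<Sum>j'\<in>UNIV. M $ j $ j' * out_state \<Phi> $ (k, j) $ (k', j')) = 0"
        using channel_conj_input_matrix[OF channel_linear[OF that], of \<Psi> M k k'] zero by simp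
      then show ?thesis
        by (simp add: M_def if_distrib if_distribR cong: if_cong)
    qed
    then have "(\<Sum>q\<in>UNIV. (\<Sum>j\<in>UNIV. c $ j * out_state \<Phi> $ (k, j) $ q) * x $ q) = 0"
      by (intro sum.neutral) auto
    then show ?thesis
      unfolding zz matrix_vector_mult_def
      by (simp add: sum_distrib_left sum_distrib_right mult.assoc) (subst sum.swap, simp)
  qed
  show ?thesis
    by (intro card_plus_le[of "UNIV :: 'n set" z]) (simp_all add: z0 z1 z2 output_nonzero)
qed

text \<open>An output that is not pure has two orthogonal nonzero vectors in its range, so every
  channel occupies at least two dimensions; the Boolean index selects one of the two.\<close>

lemma mixed_outputs_card:
  assumes mixed: "\<And>\<Phi> w. \<Phi> \<in> F \<Longrightarrow> out_state \<Phi> \<noteq> ketbra w"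
  shows "2 * card F \<le> CARD('n)\<^sup>2"
proof -
  have "\<exists>x y. out_state \<Phi> *v x \<noteq> 0 \<and> out_state \<Phi> *v y \<noteq> 0 \<and> cinner (out_state \<Phi> *v x) (out_state \<Phi> *v y) = 0"
    if "\<Phi> \<in> F" for \<Phi>
    using that mixed by (meson output_cases)
  then obtain x y where xy: "\<And>\<Phi>. \<Phi> \<in> F \<Longrightarrow> out_state \<Phi> *v x \<Phi> \<noteq> 0"
      "\<And>\<Phi>. \<Phi> \<in> F \<Longrightarrow> out_state \<Phi> *v y \<Phi> \<noteq> 0"
      "\<And>\<Phi>. \<Phi> \<in> F \<Longrightarrow> cinner (out_state \<Phi> *v x \<Phi>) (out_state \<Phi> *v y \<Phi>) = 0"
    by metis
  then have yx: "\<And>\<Phi>. \<Phi> \<in> F \<Longrightarrow> cinner (out_state \<Phi> *v y \<Phi>) (out_state \<Phi> *v x \<Phi>) = 0"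
    using cinner_eq_0_sym by blast
  have "card (F \<times> (UNIV :: bool set)) \<le> CARD('n \<times> 'n)"
  proof (rule orthogonal_family_card_le[where x = "\<lambda>(\<Phi>, b). out_state \<Phi> *v (if b then x \<Phi> else y \<Phi>)"])
    fix i j assume "i \<in> F \<times> (UNIV :: bool set)" "j \<in> F \<times> (UNIV :: bool set)" "i \<noteq> j"
    then show "cinner (case i of (\<Phi>, b) \<Rightarrow> out_state \<Phi> *v (if b then x \<Phi> else y \<Phi>))
        (case j of (\<Phi>, b) \<Rightarrow> out_state \<Phi> *v (if b then x \<Phi> else y \<Phi>)) = 0"
      by (cases i; cases j; cases "fst i = fst j") (use xy yx output_range_orthogonal in simp_all)
  qed (use fin xy in \<open>auto split: if_splits\<close>)
  then show ?thesis
    by (simp add: card_cartesian_product power2_eq_square)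
qed

text \<open>The first inequality excludes a singular input, the second forces some output to be
  pure. That one channel is then unital, which settles the common \<open>T\<close>. For qubits both
  inequalities mean at least three channels.\<close>

lemma row_sum_eq_1:
  assumes e: "orthonormal_basis e" and T: "\<And>\<Phi>. \<Phi> \<in> F \<Longrightarrow> has_classical_action e \<Phi> T"
    and "CARD('n)\<^sup>2 < card F + CARD('n)" and "CARD('n)\<^sup>2 < 2 * card F"
  shows "(\<Sum>l\<in>UNIV. T $ k $ l) = 1"
proof -
  obtain B where B: "B ** input_matrix \<Psi> = mat 1"
    using singular_input_card assms(3) matrix_left_invertible_ker[of "input_matrix \<Psi>"]
    by (metis leD)
  obtain \<Phi> w where \<Phi>: "\<Phi> \<in> F" "out_state \<Phi> = ketbra w"
    using mixed_outputs_card assms(4) by (meson leD)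
  have "\<Phi> (mat 1) = mat 1"
    by (rule pure_output_unital[OF channel_linear[OF \<Phi>(1)] channel_trace[OF \<Phi>(1)] \<Phi>(2) B])
  then show ?thesis
    using unital_classical_action[OF e channel_linear T] \<Phi> by blast
qed

text \<open>No spare dimension is left: a mixed output, or a vector outside the span of the pure
  ones, would supply one orthogonal vector too many. The outputs are therefore the projectors of an
  orthonormal basis.\<close>

lemma sum_outputs:
  assumes "card F = CARD('n)\<^sup>2"
  shows "(\<Sum>\<Phi>\<in>F. out_state \<Phi>) = mat 1"
proof -
  have "\<exists>w. cinner w w = 1 \<and> out_state \<Phi> = ketbra w" if "\<Phi> \<in> F" for \<Phi>
    using that
  proof (cases \<Phi> rule: output_cases)
    case (mixed x y)
    \<comment> \<open>\<open>\<Phi>\<close> is represented by its range vector from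
      \<open>y\<close>, which leaves the one from \<open>x\<close> as the extra vector.\<close>
    have "\<exists>u. out_state \<Theta> *v u \<noteq> 0 \<and> (\<forall>i\<in>{()}. cinner (out_state \<Phi> *v x) (out_state \<Theta> *v u) = 0)"
      if "\<Theta> \<in> F" for \<Theta>
      using that \<open>\<Phi> \<in> F\<close> mixed output_nonzero output_range_orthogonal by (metis (full_types))
    then have "card F + card {()} \<le> CARD('n)\<^sup>2"
      using mixed by (intro card_plus_le[of _ "\<lambda>_. out_state \<Phi> *v x"]) auto
    then show ?thesis using assms by simp
  qed blast
  then obtain w where w: "\<And>\<Phi>. \<Phi> \<in> F \<Longrightarrow> cinner (w \<Phi>) (w \<Phi>) = 1"
      "\<And>\<Phi>. \<Phi> \<in> F \<Longrightarrow> out_state \<Phi> = ketbra (w \<Phi>)"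
    by metis
  have wrange: "out_state \<Phi> *v w \<Phi> = w \<Phi>" if "\<Phi> \<in> F" for \<Phi>
    using w that by (simp add: ketbra_mult_vector)
  have worth: "cinner (w \<Phi>) (w \<Theta>) = (if \<Phi> = \<Theta> then 1 else 0)" if "\<Phi> \<in> F" "\<Theta> \<in> F" for \<Phi> \<Theta>
    using that w wrange output_range_orthogonal by metis
  have "(\<Sum>\<Phi>\<in>F. out_state \<Phi>) *v x = x" for x
  proof (rule ccontr)
    define y where "y = x - (\<Sum>\<Phi>\<in>F. out_state \<Phi>) *v x"
    assume "(\<Sum>\<Phi>\<in>F. out_state \<Phi>) *v x \<noteq> x"
    then have "y \<noteq> 0" by (simp add: y_def)
    have "cinner (w \<Phi>) y = 0" if "\<Phi> \<in> F" for \<Phi>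
    proof -
      have "cinner (w \<Phi>) ((\<Sum>\<Theta>\<in>F. out_state \<Theta>) *v x) = (\<Sum>\<Theta>\<in>F. cinner (w \<Theta>) x * cinner (w \<Phi>) (w \<Theta>))"
        by (simp add: matrix_vector_mult_sum_left cinner_sum_right w ketbra_mult_vector cinner_scale_right)
      also have "\<dots> = (\<Sum>\<Theta>\<in>F. if \<Theta> = \<Phi> then cinner (w \<Theta>) x else 0)"
        by (rule sum.cong) (use worth that in auto)
      also have "\<dots> = cinner (w \<Phi>) x"
        using that fin by simp
      finally show ?thesis by (simp add: y_def cinner_diff_right)
    qed
    then have "\<exists>u. out_state \<Phi> *v u \<noteq> 0 \<and> (\<forall>i\<in>{()}. cinner y (out_state \<Phi> *v u) = 0)"
      if "\<Phi> \<in> F" for \<Phi>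
      using that w(1) wrange cinner_eq_0_sym by (metis cinner_0_left zero_neq_one)
    then have "card F + card {()} \<le> CARD('n)\<^sup>2"
      using \<open>y \<noteq> 0\<close> by (intro card_plus_le[of _ "\<lambda>_. y"]) auto
    then show False using assms by simp
  qed
  then show ?thesis by (simp add: matrix_eq)
qed

text \<open>Since the outputs sum to the identity, the channels sum to a multiple of Y \<mapsto>
  tr(Y) 1, and trace preservation fixes the multiple as n. Diagonal entries in the basis
  \<open>e\<close> then read n^2 T = n.\<close>

lemma maximal_classical_action:
  assumes e: "orthonormal_basis e" and T: "\<And>\<Phi>. \<Phi> \<in> F \<Longrightarrow> has_classical_action e \<Phi> T"
    and card: "card F = CARD('n)\<^sup>2"
  shows "T $ k $ l = 1 / CARD('n)"
proof -
  have "CARD('n)\<^sup>2 < card F + CARD('n)"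
    using card by simp
  then obtain B where B: "B ** input_matrix \<Psi> = mat 1"
    using singular_input_card matrix_left_invertible_ker[of "input_matrix \<Psi>"] by (metis leD)
  then have AB: "input_matrix \<Psi> ** B = mat 1"
    by (simp add: matrix_left_right_inverse)
  then have BA: "adj B ** adj (input_matrix \<Psi>) = mat 1"
    by (simp flip: adj_matrix_mul)
  have sum: "(\<Sum>\<Phi>\<in>F. \<Phi> Y) = mat (trace (B ** Y ** adj B))" for Y
  proof -
    let ?M = "B ** Y ** adj B"
    have "input_matrix \<Psi> ** ?M ** adj (input_matrix \<Psi>) =
        (input_matrix \<Psi> ** B) ** Y ** (adj B ** adj (input_matrix \<Psi>))"
      by (simp only: matrix_mul_assoc)
    then have Y: "input_matrix \<Psi> ** ?M ** adj (input_matrix \<Psi>) = Y"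
      by (simp add: AB BA)
    have "(\<Sum>\<Phi>\<in>F. \<Phi> Y $ k $ k') = (\<Sum>\<Phi>\<in>F. \<Sum>j\<in>UNIV. \<Sum>j'\<in>UNIV. ?M $ j $ j' * out_state \<Phi> $ (k, j) $ (k', j'))"
      for k k'
      by (rule sum.cong) (use channel_conj_input_matrix[OF channel_linear, of _ \<Psi> ?M k k'] Y in auto)
    also have "\<dots> k k' = (\<Sum>j\<in>UNIV. \<Sum>j'\<in>UNIV. ?M $ j $ j' * (\<Sum>\<Phi>\<in>F. out_state \<Phi>) $ (k, j) $ (k', j'))"
      for k k'
      by (subst sum.swap, rule sum.cong, rule refl, subst sum.swap) (simp add: sum_distrib_left)
    also have "\<dots> k k' = mat (trace ?M) $ k $ k'" for k k'
      unfolding sum_outputs[OF card] by (simp add: mat_def trace_def if_distrib cong: if_cong)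
    finally show ?thesis by (simp add: vec_eq_iff)
  qed
  \<comment> \<open>Taking traces in \<open>sum\<close> evaluates the scalar factor and eliminates
    the unknown inverse \<open>B\<close>.\<close>
  have tr: "CARD('n) * trace (B ** Y ** adj B) = CARD('n)\<^sup>2 * trace Y" for Y
  proof -
    have "trace (\<Sum>\<Phi>\<in>F. \<Phi> Y) = (\<Sum>\<Phi>\<in>F. trace (\<Phi> Y))"
      by (simp add: trace_def sum.swap[of _ F])
    also have "\<dots> = CARD('n)\<^sup>2 * trace Y"
      using card by (simp add: channel_trace)
    finally show ?thesis
      unfolding sum by (simp add: trace_def mat_def)
  qed
  have "trace (ketbra (e l)) = 1"
    using e by (simp add: trace_ketbra orthonormal_basis_def)
  then have "trace (B ** ketbra (e l) ** adj B) = CARD('n)"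
    using tr[of "ketbra (e l)"] by (simp add: power2_eq_square)
  then have S: "(\<Sum>\<Phi>\<in>F. \<Phi> (ketbra (e l))) = mat (CARD('n))"
    using sum by simp
  have "complex_of_real (CARD('n)\<^sup>2 * T $ k $ l) = (\<Sum>\<Phi>\<in>F. complex_of_real (T $ k $ l))"
    by (simp add: card)
  also have "\<dots> = (\<Sum>\<Phi>\<in>F. cinner (e k) (\<Phi> (ketbra (e l)) *v e k))"
    by (rule sum.cong) (use T in \<open>auto simp: has_classical_action_def\<close>)
  also have "\<dots> = cinner (e k) ((\<Sum>\<Phi>\<in>F. \<Phi> (ketbra (e l))) *v e k)"
    by (simp add: matrix_vector_mult_sum_left cinner_sum_right)
  also have "\<dots> = cinner (e k) (complex_of_nat CARD('n) *s e k)"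
    unfolding S mat_mult_vector ..
  also have "\<dots> = complex_of_real CARD('n)"
    using e by (simp add: cinner_scale_right orthonormal_basis_def)
  finally have "CARD('n)\<^sup>2 * T $ k $ l = CARD('n)"
    using of_real_eq_iff by blast
  then show ?thesis by (simp add: power2_eq_square field_simps)
qed

end

section \<open>Channels with two Kraus operators and lower bounds\<close>

text \<open>Two operators serve both constructions: unitary channels have \<open>K1 = 0\<close>, and
  the non-unital ones use a \<open>K1\<close> that annihilates the input.\<close>

definition kraus_pair :: "complex^'n^'n \<Rightarrow> complex^'n^'n \<Rightarrow> complex^'n^'n \<Rightarrow> complex^'n^'n" where
  "kraus_pair K0 K1 X = K0 ** X ** adj K0 + K1 ** X ** adj K1"

lemma linear_kraus_pair: "Vector_Spaces.linear mat_scale mat_scale (kraus_pair K0 K1)"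
proof -
  have "vector_space (mat_scale :: complex \<Rightarrow> complex^'a^'a \<Rightarrow> _)"
    by unfold_locales (simp_all add: vec_eq_iff algebra_simps)
  moreover have "kraus_pair K0 K1 (X + Y) = kraus_pair K0 K1 X + kraus_pair K0 K1 Y" for X Y
    by (simp add: kraus_pair_def matrix_add_ldistrib matrix_add_rdistrib)
  moreover have "kraus_pair K0 K1 (mat_scale c X) = mat_scale c (kraus_pair K0 K1 X)" for c X
    by (simp add: kraus_pair_def vec_eq_iff matrix_matrix_mult_def sum_distrib_left distrib_left mult_ac)
  ultimately show ?thesis
    by (simp add: Vector_Spaces.linear_iff)
qed

text \<open>Each Kraus operator moves onto the test vectors as its adjoint, so the form of the
  output is a sum of two forms of the input.\<close>

lemma completely_positive_kraus_pair: "completely_positive (kraus_pair K0 K1)"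
  unfolding completely_positive_def block_psd_def
proof (intro allI impI)
  fix k X and v :: "nat \<Rightarrow> complex^'a"
  assume X: "\<forall>v :: nat \<Rightarrow> complex^'a. (\<Sum>i<k. \<Sum>j<k. cinner (v i) (X i j *v v j)) \<in> \<real>\<^sub>\<ge>\<^sub>0"
  have "cinner (v i) (kraus_pair K0 K1 (X i j) *v v j) =
      cinner (adj K0 *v v i) (X i j *v (adj K0 *v v j)) + cinner (adj K1 *v v i) (X i j *v (adj K1 *v v j))" for i j
    by (simp add: kraus_pair_def matrix_vector_mult_add_rdistrib cinner_add_right
        cinner_matrix_vector[of _ K0] cinner_matrix_vector[of _ K1] flip: matrix_vector_mul_assoc)
  then have "(\<Sum>i<k. \<Sum>j<k. cinner (v i) (kraus_pair K0 K1 (X i j) *v v j)) =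
      (\<Sum>i<k. \<Sum>j<k. cinner (adj K0 *v v i) (X i j *v (adj K0 *v v j))) +
      (\<Sum>i<k. \<Sum>j<k. cinner (adj K1 *v v i) (X i j *v (adj K1 *v v j)))"
    by (simp add: sum.distrib)
  also have "\<dots> \<in> \<real>\<^sub>\<ge>\<^sub>0"
    using X[rule_format, of "\<lambda>i. adj K0 *v v i"] X[rule_format, of "\<lambda>i. adj K1 *v v i"]
    by (rule nonneg_Reals_add_I)
  finally show "(\<Sum>i<k. \<Sum>j<k. cinner (v i) (kraus_pair K0 K1 (X i j) *v v j)) \<in> \<real>\<^sub>\<ge>\<^sub>0" .
qed

lemma quantum_channel_kraus_pair:
  assumes "adj K0 ** K0 + adj K1 ** K1 = mat 1"
  shows "quantum_channel (kraus_pair K0 K1)"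
proof -
  have "trace (kraus_pair K0 K1 A) = trace A" for A
  proof -
    have "trace (kraus_pair K0 K1 A) = trace (adj K0 ** (K0 ** A)) + trace (adj K1 ** (K1 ** A))"
      by (simp add: kraus_pair_def trace_add trace_mul_sym[of "K0 ** A"] trace_mul_sym[of "K1 ** A"])
    also have "\<dots> = trace ((adj K0 ** K0 + adj K1 ** K1) ** A)"
      by (simp add: matrix_add_rdistrib trace_add matrix_mul_assoc)
    finally show ?thesis by (simp add: assms)
  qed
  then show ?thesis
    by (simp add: quantum_channel_def linear_kraus_pair completely_positive_kraus_pair)
qed

text \<open>Inverse of \<open>input_matrix\<close>; it turns the Hilbert-Schmidt product of matrices
  into the inner product of bipartite vectors.\<close>

definition flatten :: "complex^'k^'n \<Rightarrow> complex^('n::finite \<times> 'k::finite)" where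
  "flatten M = (\<chi> p. M $ fst p $ snd p)"

lemma cinner_flatten: "cinner (flatten M) (flatten N) = trace (adj M ** N)"
  by (simp add: flatten_def cinner_def trace_def matrix_matrix_mult_def sum_prod_UNIV)

lemma tensor_id_kraus_pair:
  assumes "K1 ** A = 0"
  shows "tensor_id (kraus_pair K0 K1) (ketbra (flatten A)) = ketbra (flatten (K0 ** A))"
proof -
  have *: "(K ** (\<chi> i i'. A $ i $ j * cnj (A $ i' $ j')) ** adj K) $ k $ k' = (K ** A) $ k $ j * cnj ((K ** A) $ k' $ j')"
    for K j j' k k'
    by (simp add: matrix_matrix_mult_def sum_product sum_distrib_left mult_ac)
  show ?thesis
    using assms by (simp add: vec_eq_iff tensor_id_def kraus_pair_def flatten_def *)
qed

text \<open>Reduces lower bounds to matrix identities in coordinates with respect to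
  \<open>e\<close>. As \<open>L1 m\<close> kills the input, all outputs are pure, and orthogonality
  of supports is that of the vectors \<open>L0 m ** B\<close>.\<close>

lemma distinguishability_number_ge:
  fixes L0 L1 :: "nat \<Rightarrow> complex^'n^'n" and B :: "complex^'n^'n"
  assumes e: "orthonormal_basis e"
    and tp: "\<And>m. m < N \<Longrightarrow> adj (L0 m) ** L0 m + adj (L1 m) ** L1 m = mat 1"
    and T: "\<And>m k l. m < N \<Longrightarrow> T $ k $ l = (cmod (L0 m $ k $ l))\<^sup>2 + (cmod (L1 m $ k $ l))\<^sup>2"
    and B: "trace (adj B ** B) = 1"
    and L1B: "\<And>m. m < N \<Longrightarrow> L1 m ** B = 0"
    and orth: "\<And>m m'. m < N \<Longrightarrow> m' < N \<Longrightarrow> m \<noteq> m' \<Longrightarrow> trace (adj (L0 m ** B) ** (L0 m' ** B)) = 0"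
  shows "enat N \<le> distinguishability_number e T"
proof -
  define E where "E = (\<chi> i k. e k $ i)"
  have E: "adj E ** E = mat 1"
    using e by (simp add: E_def vec_eq_iff matrix_matrix_mult_def mat_def
        orthonormal_basis_def cinner_def)
  then have E': "E ** adj E = mat 1"
    by (simp add: matrix_left_right_inverse)
  have E_cancel: "X ** adj E ** E = X" "Y ** E ** adj E = Y" for X Y :: "complex^'n^'n"
    by (simp_all add: E E' flip: matrix_mul_assoc)
  have Ee: "e k = E *v axis k 1" for k
    by (simp add: E_def vec_eq_iff matrix_vector_mult_def axis_def if_distrib cong: if_cong)
  define K where "K M = E ** M ** adj E" for M
  define \<Phi> where "\<Phi> m = kraus_pair (K (L0 m)) (K (L1 m))" for m
  define \<Psi> where "\<Psi> = flatten (E ** B)"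
  define w where "w m = flatten (E ** (L0 m ** B))" for m
  have K_adj: "adj (K M) ** K M = E ** (adj M ** M) ** adj E" for M
    by (simp add: K_def adj_matrix_mul matrix_mul_assoc E_cancel)
  have K_cinner: "cinner (e k) (K M *v e l) = M $ k $ l" for M k l
  proof -
    have "cinner (e k) (K M *v e l) = cinner ((adj E ** E) *v axis k 1) (M *v ((adj E ** E) *v axis l 1))"
      by (simp add: Ee K_def cinner_matrix_vector[of _ E] flip: matrix_vector_mul_assoc)
    then show ?thesis by (simp add: E cinner_matrix_vector_axis)
  qed
  have flat: "cinner (flatten (E ** X)) (flatten (E ** Y)) = trace (adj X ** Y)" for X Y :: "complex^'n^'n"
    by (simp add: cinner_flatten adj_matrix_mul matrix_mul_assoc E_cancel)
  have channel: "quantum_channel (\<Phi> m)" if "m < N" for m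
  proof -
    have "adj (K (L0 m)) ** K (L0 m) + adj (K (L1 m)) ** K (L1 m) =
        E ** (adj (L0 m) ** L0 m + adj (L1 m) ** L1 m) ** adj E"
      by (simp add: K_adj matrix_add_ldistrib matrix_add_rdistrib)
    then show ?thesis
      using tp[OF that] by (simp add: \<Phi>_def quantum_channel_kraus_pair E')
  qed
  have action: "has_classical_action e (\<Phi> m) T" if "m < N" for m
    unfolding has_classical_action_def
  proof (intro allI)
    fix k l
    have *: "cinner (e k) (ketbra u *v e k) = complex_of_real ((cmod (cinner (e k) u))\<^sup>2)" for u
      by (simp only: ketbra_mult_vector cinner_scale_right complex_norm_square cnj_cinner mult.commute)
    show "complex_of_real (T $ k $ l) = cinner (e k) (\<Phi> m (ketbra (e l)) *v e k)"
      by (simp add: \<Phi>_def kraus_pair_def matrix_ketbra_adj matrix_vector_mult_add_rdistrib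
          cinner_add_right * K_cinner T[OF that])
  qed
  have out: "tensor_id (\<Phi> m) (ketbra \<Psi>) = ketbra (w m)" if "m < N" for m
  proof -
    have "K (L1 m) ** (E ** B) = E ** (L1 m ** B)" "K (L0 m) ** (E ** B) = E ** (L0 m ** B)"
      by (simp_all add: K_def matrix_mul_assoc E_cancel)
    then show ?thesis
      by (simp add: \<Phi>_def \<Psi>_def w_def tensor_id_kraus_pair L1B[OF that])
  qed
  have worth: "cinner (w m) (w m') = 0" if "m < N" "m' < N" "m \<noteq> m'" for m m'
    unfolding w_def flat using orth that by blast
  have "cinner (w m) (w m) = 1" if "m < N" for m
  proof -
    have "(adj (L0 m) ** L0 m + adj (L1 m) ** L1 m) ** B = adj (L0 m) ** (L0 m ** B)"
      by (simp add: matrix_add_rdistrib L1B[OF that] flip: matrix_mul_assoc)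
    then have "adj (L0 m) ** (L0 m ** B) = B"
      by (simp add: tp[OF that])
    then show ?thesis
      unfolding w_def flat adj_matrix_mul by (simp add: B flip: matrix_mul_assoc)
  qed
  \<comment> \<open>A set of channels is counted, so they must differ: equal channels would share an
    output vector, but distinct indices give orthogonal unit vectors.\<close>
  then have inj: "inj_on \<Phi> {..<N}"
  proof (intro inj_onI)
    fix m m' assume m: "m \<in> {..<N}" "m' \<in> {..<N}" "\<Phi> m = \<Phi> m'"
      and w1: "\<And>m. m < N \<Longrightarrow> cinner (w m) (w m) = 1"
    then have "ketbra (w m) *v w m = ketbra (w m') *v w m"
      using out by (metis lessThan_iff)
    then have eq: "w m = cinner (w m') (w m) *s w m'"
      using m w1[of m] by (simp add: ketbra_mult_vector)
    show "m = m'"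
    proof (rule ccontr)
      assume "m \<noteq> m'"
      then have "w m = 0"
        using eq worth[of m' m] m by simp
      then show False
        using w1[of m] m by simp
    qed
  qed
  have "cinner \<Psi> \<Psi> = 1"
    unfolding \<Psi>_def flat by (rule B)
  then have "(norm \<Psi>)\<^sup>2 = 1"
    unfolding cinner_self by (rule of_real_eq_1_iff[THEN iffD1])
  then have "norm \<Psi> = 1"
    using power2_eq_iff_nonneg[of "norm \<Psi>" 1] by simp
  moreover have "pairwise (\<lambda>\<Phi> \<Theta>. orthogonal_supports (tensor_id \<Phi> (ketbra \<Psi>)) (tensor_id \<Theta> (ketbra \<Psi>))) (\<Phi> ` {..<N})"
  proof (rule pairwise_imageI)
    fix m m' assume m: "m \<in> {..<N}" "m' \<in> {..<N}" "m \<noteq> m'"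
    then have "ketbra (w m') ** ketbra (w m) = 0"
      using worth[of m' m] unfolding matrix_eq
      by (simp add: ketbra_mult_vector vec.scale flip: matrix_vector_mul_assoc)
    then show "orthogonal_supports (tensor_id (\<Phi> m) (ketbra \<Psi>)) (tensor_id (\<Phi> m') (ketbra \<Psi>))"
      using m by (simp add: out orthogonal_supportsI)
  qed
  ultimately have "perfectly_distinguishable (\<Phi> ` {..<N})"
    unfolding perfectly_distinguishable_def by blast
  moreover have "card (\<Phi> ` {..<N}) = N"
    by (simp add: card_image[OF inj])
  ultimately show ?thesis
    unfolding distinguishability_number_def
    by (intro Sup_upper CollectI exI[of _ "\<Phi> ` {..<N}"]) (use channel action in auto)
qed

lemma distinguishability_number_le:
  assumes "\<And>F \<Psi>. discriminated_channels F \<Psi> \<Longrightarrow> (\<And>\<Phi>. \<Phi> \<in> F \<Longrightarrow> has_classical_action e \<Phi> T) \<Longrightarrow> card F \<le> N"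
  shows "distinguishability_number e T \<le> enat N"
  unfolding distinguishability_number_def
proof (rule Sup_least, clarify)
  fix F :: "(complex^'a^'a \<Rightarrow> complex^'a^'a) set"
  assume "finite F" "\<forall>\<Phi>\<in>F. quantum_channel \<Phi> \<and> has_classical_action e \<Phi> T" "perfectly_distinguishable F"
  then show "enat (card F) \<le> enat N"
    unfolding perfectly_distinguishable_def by (auto intro!: assms discriminated_channels.intro)
qed

section \<open>Explicit qubit families\<close>

lemma distinguishability_number_ge_unitary:
  fixes u v :: "nat \<Rightarrow> complex" and T :: "real^2^2"
  assumes e: "orthonormal_basis e" and T: "T = vector [vector [a, 1 - a], vector [1 - a, a]]"
    and u: "\<And>m. m < N \<Longrightarrow> (cmod (u m))\<^sup>2 = a" and v: "\<And>m. m < N \<Longrightarrow> (cmod (v m))\<^sup>2 = 1 - a"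
    and orth: "\<And>m m'. m < N \<Longrightarrow> m' < N \<Longrightarrow> m \<noteq> m' \<Longrightarrow> Re (cnj (u m) * u m' + cnj (v m) * v m') = 0"
  shows "enat N \<le> distinguishability_number e T"
proof -
  \<comment> \<open>The SU(2) matrix with first column (u, v). Its trace against another such matrix
    is real, hence orthogonality in \<real>^4 and not in \<complex>^2; \<open>mat r\<close> is the
    maximally entangled input.\<close>
  define L0 :: "nat \<Rightarrow> complex^2^2"
    where "L0 m = vector [vector [u m, - cnj (v m)], vector [v m, cnj (u m)]]" for m
  define r :: complex where "r = complex_of_real (1 / sqrt 2)"
  have r: "cnj r = r" "r * r = 1/2"
    by (simp_all add: r_def flip: of_real_mult)
  show ?thesis
  proof (rule distinguishability_number_ge[OF e, of _ L0 "\<lambda>_. 0" _ "mat r"])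
    fix m assume m: "m < N"
    have "cnj (u m) * u m + cnj (v m) * v m = complex_of_real ((cmod (u m))\<^sup>2 + (cmod (v m))\<^sup>2)"
      by (simp only: of_real_add complex_norm_square mult.commute)
    then have "cnj (u m) * u m + cnj (v m) * v m = 1"
      using u[OF m] v[OF m] by simp
    then show "adj (L0 m) ** L0 m + adj 0 ** 0 = mat 1"
      by (simp add: L0_def vec_eq_iff forall_2 matrix_matrix_mult_def sum_2 mat_def algebra_simps)
    fix k l
    show "T $ k $ l = (cmod (L0 m $ k $ l))\<^sup>2 + (cmod (0 $ k $ l))\<^sup>2"
      using u[OF m] v[OF m] exhaust_2[of k] exhaust_2[of l] by (auto simp: T L0_def)
  next
    fix m m' assume m: "m < N" "m' < N" "m \<noteq> m'"
    define q where "q = cnj (u m) * u m' + cnj (v m) * v m'"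
    have "trace (adj (L0 m ** mat r) ** (L0 m' ** mat r)) = r * r * (q + cnj q)"
      by (simp add: L0_def trace_def matrix_matrix_mult_def sum_2 mat_def r(1) q_def algebra_simps)
    moreover have "q + cnj q = 0"
      using orth[OF m] by (simp only: complex_add_cnj flip: q_def) simp
    ultimately show "trace (adj (L0 m ** mat r) ** (L0 m' ** mat r)) = 0"
      by simp
  qed (simp_all add: trace_def matrix_matrix_mult_def sum_2 mat_def r vec_eq_iff)
qed

lemma three_unitary_channels:
  fixes a :: real
  assumes "1/3 \<le> a" "a \<le> 1/2"
  obtains u v :: "nat \<Rightarrow> complex" where
    "\<And>m. m < 3 \<Longrightarrow> (cmod (u m))\<^sup>2 = a" "\<And>m. m < 3 \<Longrightarrow> (cmod (v m))\<^sup>2 = 1 - a"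
    "\<And>m m'. m < 3 \<Longrightarrow> m' < 3 \<Longrightarrow> m \<noteq> m' \<Longrightarrow> Re (cnj (u m) * u m' + cnj (v m) * v m') = 0"
proof -
  \<comment> \<open>A three-dimensional subspace of \<open>\<real>\<^sup>4\<close> on which the form \<open>|u|\<^sup>2\<close> has the eigenvalues \<open>1, t, 0\<close>
    has an orthonormal basis with constant diagonal \<open>a\<close> (Schur-Horn), as \<open>3a = 1 + t\<close>; the basis below
    is real for \<open>t \<le> 1/2\<close> only, the other case follows by exchanging \<open>u\<close> and \<open>v\<close>.\<close>
  define t where "t = 3 * a - 1"
  have t: "0 \<le> t" "t \<le> 1/2" using assms by (simp_all add: t_def)
  \<comment> \<open>Solution of c^2 + s^2 = 1 and c^2 + s^2 t = a, a rotation in the plane of the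
    eigenvectors for 1 and t that produces the diagonal value a.\<close>
  define c where "c = sqrt ((1 - 2 * t) / (3 * (1 - t)))"
  define s where "s = sqrt ((2 - t) / (3 * (1 - t)))"
  define \<tau> where "\<tau> = sqrt t"
  define \<kappa> where "\<kappa> = sqrt (1 - t)"
  define r where "r = 1 / sqrt (2 :: real)"
  have c2: "c * c = (1 - 2 * t) / (3 * (1 - t))" and s2: "s * s = (2 - t) / (3 * (1 - t))"
    and \<tau>2: "\<tau> * \<tau> = t" and \<kappa>2: "\<kappa> * \<kappa> = 1 - t" and r2: "r * r = 1/2"
    using t by (simp_all add: c_def s_def \<tau>_def \<kappa>_def r_def)
  have cs: "c * c + s * s = 1" "c * c + s * s * t = a"
    using t unfolding c2 s2 by (simp_all add: t_def divide_simps) (simp_all add: algebra_simps)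
  have ta: "t = 3 * a - 1" by (simp add: t_def)
  \<comment> \<open>In coordinates (Re u, Im u, Re v, Im v) let f1 = (1, 0, 0, 0), f2 = (0, \<tau>,
    \<kappa>, 0), f3 = (0, 0, 0, 1). The three vectors are c f1 - s f2 and r (s f1 + c f2
    \<plusminus> f3).\<close>
  define p where "p = s * \<tau>"
  define q where "q = s * \<kappa>"
  define x where "x = r * s"
  define y where "y = r * c * \<tau>"
  define z where "z = r * c * \<kappa>"
  note defs = p_def q_def x_def y_def z_def
  have norms: "c\<^sup>2 + p\<^sup>2 = a" "q\<^sup>2 = 1 - a" "x\<^sup>2 + y\<^sup>2 = a" "z\<^sup>2 + r\<^sup>2 = 1 - a"
    unfolding defs using cs ta \<tau>2 \<kappa>2 r2 by algebra+
  have orth: "c * x - p * y - q * z = 0" "x * x + y * y + z * z - r * r = 0"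
    unfolding defs using cs ta \<tau>2 \<kappa>2 r2 by algebra+
  define u where "u m = (if m = 0 then Complex c (- p) else Complex x y)" for m :: nat
  define v where "v m = (if m = 0 then Complex (- q) 0 else Complex z (if m = 1 then r else - r))" for m :: nat
  show thesis
  proof (rule that[of u v])
    show "(cmod (u m))\<^sup>2 = a" "(cmod (v m))\<^sup>2 = 1 - a" for m
      using norms by (simp_all add: u_def v_def cmod_power2)
    show "Re (cnj (u m) * u m' + cnj (v m) * v m') = 0" if "m < 3" "m' < 3" "m \<noteq> m'" for m m'
    proof -
      have "m \<in> {0, 1, 2}" "m' \<in> {0, 1, 2}" using that by auto
      then show ?thesis
        using orth that(3) by (auto simp: u_def v_def algebra_simps)
    qed
  qed
qed

text \<open>The second equation says that the first diagonal entry in \<open>two_channels\<close> is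
  a. In double angles it is g S - D C = a + b - 1 for a point (C, S) of the unit circle, solvable
  because |a + b - 1| is at most 1 - |a - b|, the length of (-D, g).\<close>

lemma two_channels_parameters:
  fixes a b :: real
  assumes "0 \<le> a" "a \<le> 1" "0 \<le> b" "b \<le> 1" "\<bar>a - b\<bar> \<le> 1/2"
  obtains x y where "x\<^sup>2 + y\<^sup>2 = 1" "(a - b) * y\<^sup>2 + sqrt (1 - 2 * \<bar>a - b\<bar>) * x * y = a - 1/2"
proof -
  define D where "D = a - b"
  define g where "g = sqrt (1 - 2 * \<bar>D\<bar>)"
  define R where "R = 1 - \<bar>D\<bar>"
  have R: "R > 0" using assms by (simp add: R_def D_def)
  have g2: "g\<^sup>2 = 1 - 2 * \<bar>D\<bar>" using assms by (simp add: g_def D_def)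
  have "D\<^sup>2 + g\<^sup>2 = R\<^sup>2"
    unfolding g2 R_def by (simp add: power2_eq_square algebra_simps)
  define w where "w = (a + b - 1) / R"
  have "\<bar>a + b - 1\<bar> \<le> R" using assms by (simp add: R_def D_def)
  then have "\<bar>w\<bar> \<le> 1" using R by (simp add: w_def)
  then have w: "w\<^sup>2 \<le> 1" by (simp add: abs_square_le_1)
  define z where "z = sqrt (1 - w\<^sup>2)"
  have z: "w\<^sup>2 + z\<^sup>2 = 1" using w by (simp add: z_def)
  \<comment> \<open>The unit vector with component w along (-D, g)/R and z along the perpendicular
    (-g, -D)/R.\<close>
  define C where "C = (- w * D - z * g) / R"
  define S where "S = (w * g - z * D) / R"
  have "C\<^sup>2 + S\<^sup>2 = ((w\<^sup>2 + z\<^sup>2) * (D\<^sup>2 + g\<^sup>2)) / R\<^sup>2"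
    by (simp add: C_def S_def power_divide flip: add_divide_distrib) (simp add: power2_eq_square algebra_simps)
  also have "\<dots> = 1" using z \<open>D\<^sup>2 + g\<^sup>2 = R\<^sup>2\<close> R by simp
  finally obtain \<phi> where \<phi>: "C = cos \<phi>" "S = sin \<phi>"
    by (rule sincos_total_2pi)
  have "g * S - D * C = (g * (w * g - z * D) - D * (- w * D - z * g)) / R"
    by (simp only: C_def S_def times_divide_eq_right flip: diff_divide_distrib)
  also have "\<dots> = w * (D\<^sup>2 + g\<^sup>2) / R"
    by (simp add: algebra_simps power2_eq_square)
  also have "\<dots> = a + b - 1"
    using R \<open>D\<^sup>2 + g\<^sup>2 = R\<^sup>2\<close> by (simp add: w_def power2_eq_square)
  finally have gS: "g * S - D * C = a + b - 1" .
  define x where "x = cos (\<phi> / 2)"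
  define y where "y = sin (\<phi> / 2)"
  have xy: "x\<^sup>2 + y\<^sup>2 = 1" by (simp add: x_def y_def)
  have CS: "C = 1 - 2 * y\<^sup>2" "S = 2 * x * y"
    using cos_double_sin[of "\<phi> / 2"] sin_double[of "\<phi> / 2"] by (simp_all add: \<phi> x_def y_def)
  have "D * y\<^sup>2 + g * x * y = a - 1/2"
    using gS unfolding CS by (simp add: D_def algebra_simps)
  with xy show thesis using that by (simp add: D_def g_def)
qed

lemma two_channels:
  fixes T :: "real^2^2"
  assumes e: "orthonormal_basis e" and ab: "0 \<le> a" "a \<le> 1" "0 \<le> b" "b \<le> 1" "\<bar>a - b\<bar> \<le> 1/2"
    and T: "T = vector [vector [a, 1 - b], vector [1 - a, b]]"
  shows "2 \<le> distinguishability_number e T"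
proof -
  \<comment> \<open>The Kraus operator \<open>M0 m\<close> maps the unit vector \<open>\<psi> = (x, y)\<close> to \<open>(1, \<plusminus>1)/\<surd>2\<close> and \<open>\<psi>\<^sup>\<bottom> = (y, -x)\<close> to
    \<open>g (1, \<minusplus>1)/\<surd>2\<close>; \<open>M1\<close> annihilates \<open>\<psi>\<close> and takes up the rest of \<open>\<psi>\<^sup>\<bottom>\<close>.\<close>
  obtain x y where xy: "x\<^sup>2 + y\<^sup>2 = 1" and
    sol: "(a - b) * y\<^sup>2 + sqrt (1 - 2 * \<bar>a - b\<bar>) * x * y = a - 1/2"
    using two_channels_parameters ab by blast
  define g where "g = sqrt (1 - 2 * \<bar>a - b\<bar>)"
  \<comment> \<open>\<open>M1\<close> sends the second unit vector to (p, q). Completeness needs g^2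
    + p^2 + q^2 = 1, and p^2 - q^2 = 2 (a - b) supplies the deviation from unitality; one of p, q is
    0.\<close>
  define p where "p = sqrt (\<bar>a - b\<bar> + (a - b))"
  define q where "q = sqrt (\<bar>a - b\<bar> - (a - b))"
  define r where "r = 1 / sqrt (2 :: real)"
  have g2: "g * g = 1 - 2 * \<bar>a - b\<bar>" and p2: "p * p = \<bar>a - b\<bar> + (a - b)"
    and q2: "q * q = \<bar>a - b\<bar> - (a - b)" and r2: "r * r = 1/2"
    using ab by (auto simp: g_def p_def q_def r_def)
  define s where "s m = (if m = 0 then 1 else -1 :: real)" for m :: nat
  define M0 :: "nat \<Rightarrow> real^2^2" where
    "M0 m = vector [vector [r * (x + g * y), r * (y - g * x)], vector [s m * r * (x - g * y), s m * r * (y + g * x)]]" for m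
  define M1 :: "real^2^2" where "M1 = vector [vector [p * y, - p * x], vector [q * y, - q * x]]"
  \<comment> \<open>A product input: the ancilla stays in its first basis vector.\<close>
  define B :: "real^2^2" where "B = vector [vector [x, 0], vector [y, 0]]"
  have s2: "s m * s m = 1" for m by (simp add: s_def)
  let ?c = "map_matrix complex_of_real :: real^2^2 \<Rightarrow> complex^2^2"
  have mul: "?c X ** ?c Y = ?c (X ** Y)" for X Y
    by (simp add: vec_eq_iff matrix_matrix_mult_def)
  have adj: "adj (?c X) = ?c (transpose X)" for X
    by (simp add: vec_eq_iff transpose_def)
  have add: "?c X + ?c Y = ?c (X + Y)" for X Y
    by (simp add: vec_eq_iff)
  have one: "?c (mat 1) = mat 1"
    by (simp add: vec_eq_iff mat_def)
  have trace: "trace (?c X) = complex_of_real (trace X)" for X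
    by (simp add: trace_def)
  have "enat 2 \<le> distinguishability_number e T"
  proof (rule distinguishability_number_ge[OF e, of _ "\<lambda>m. ?c (M0 m)" "\<lambda>_. ?c M1" _ "?c B"])
    fix m :: nat
    note hyps = xy sol[folded g_def] g2 p2 q2 r2 s2[of m]
    have "r * (x + g * y) * (r * (x + g * y)) + s m * r * (x - g * y) * (s m * r * (x - g * y))
        + p * y * (p * y) + q * y * (q * y) = 1"
      "r * (x + g * y) * (r * (y - g * x)) + s m * r * (x - g * y) * (s m * r * (y + g * x))
        - p * y * (p * x) - q * y * (q * x) = 0"
      "r * (y - g * x) * (r * (y - g * x)) + s m * r * (y + g * x) * (s m * r * (y + g * x))
        + p * x * (p * x) + q * x * (q * x) = 1"
      using hyps by algebra+
    then have "transpose (M0 m) ** M0 m + transpose M1 ** M1 = mat 1"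
      by (simp add: vec_eq_iff forall_2 matrix_matrix_mult_def sum_2 mat_def transpose_def M0_def M1_def algebra_simps)
    then show "adj (?c (M0 m)) ** ?c (M0 m) + adj (?c M1) ** ?c M1 = mat 1"
      by (simp add: adj mul add one)
    fix k l
    \<comment> \<open>The first equation is \<open>sol\<close>. The others follow because the first
      row sums to 1 + a - b and both columns sum to 1.\<close>
    have "(r * (x + g * y))\<^sup>2 + (p * y)\<^sup>2 = a" "(r * (y - g * x))\<^sup>2 + (- p * x)\<^sup>2 = 1 - b"
      "(s m * r * (x - g * y))\<^sup>2 + (q * y)\<^sup>2 = 1 - a" "(s m * r * (y + g * x))\<^sup>2 + (- q * x)\<^sup>2 = b"
      using hyps by algebra+
    then show "T $ k $ l = (cmod (?c (M0 m) $ k $ l))\<^sup>2 + (cmod (?c M1 $ k $ l))\<^sup>2"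
      using exhaust_2[of k] exhaust_2[of l] by (auto simp: T M0_def M1_def)
    have "M1 ** B = 0"
      by (simp add: vec_eq_iff forall_2 matrix_matrix_mult_def sum_2 M1_def B_def)
    then show "?c M1 ** ?c B = 0"
      by (simp add: mul) (simp add: vec_eq_iff)
  next
    have "trace (transpose B ** B) = 1"
      using xy by (simp add: trace_def matrix_matrix_mult_def sum_2 transpose_def B_def power2_eq_square)
    then show "trace (adj (?c B) ** ?c B) = 1"
      by (simp add: adj mul trace)
  next
    fix m m' :: nat assume "m < 2" "m' < 2" "m \<noteq> m'"
    then have ss: "s m * s m' = -1" by (auto simp: s_def)
    have "r * (x + g * y) * x + r * (y - g * x) * y = r" "s n * r * (x - g * y) * x + s n * r * (y + g * x) * y = s n * r" for n
      using xy by algebra+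
    then have M0B: "M0 n ** B = vector [vector [r, 0], vector [s n * r, 0]]" for n
      by (simp add: vec_eq_iff forall_2 matrix_matrix_mult_def sum_2 M0_def B_def)
    have "r * r + s m * r * (s m' * r) = 0"
      using ss by algebra
    then have "trace (transpose (M0 m ** B) ** (M0 m' ** B)) = 0"
      unfolding M0B by (simp add: trace_def matrix_matrix_mult_def sum_2 transpose_def)
    then show "trace (adj (?c (M0 m) ** ?c B) ** (?c (M0 m') ** ?c B)) = 0"
      by (simp add: adj mul trace)
  qed
  then show ?thesis by (simp add: numeral_eq_enat)
qed

lemma three_channels:
  fixes T :: "real^2^2"
  assumes e: "orthonormal_basis e" and a: "1/3 \<le> a" "a \<le> 2/3"
    and T: "T = vector [vector [a, 1 - a], vector [1 - a, a]]"
  shows "3 \<le> distinguishability_number e T"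
proof -
  obtain u v :: "nat \<Rightarrow> complex" where uv:
      "\<And>m. m < 3 \<Longrightarrow> (cmod (u m))\<^sup>2 = a" "\<And>m. m < 3 \<Longrightarrow> (cmod (v m))\<^sup>2 = 1 - a"
      "\<And>m m'. m < 3 \<Longrightarrow> m' < 3 \<Longrightarrow> m \<noteq> m' \<Longrightarrow> Re (cnj (u m) * u m' + cnj (v m) * v m') = 0"
  proof (cases "a \<le> 1/2")
    case True
    show ?thesis
      by (rule three_unitary_channels[OF a(1) True]) (rule that)
  next
    case False
    then have "1/3 \<le> 1 - a" "1 - a \<le> 1/2" using a by auto
    then show ?thesis
    proof (rule three_unitary_channels)
      fix u v :: "nat \<Rightarrow> complex"
      assume "\<And>m. m < 3 \<Longrightarrow> (cmod (u m))\<^sup>2 = 1 - a" "\<And>m. m < 3 \<Longrightarrow> (cmod (v m))\<^sup>2 = 1 - (1 - a)"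
        "\<And>m m'. m < 3 \<Longrightarrow> m' < 3 \<Longrightarrow> m \<noteq> m' \<Longrightarrow> Re (cnj (u m) * u m' + cnj (v m) * v m') = 0"
      then show ?thesis
        by (intro that[of v u]) (simp_all add: add.commute)
    qed
  qed
  have "enat 3 \<le> distinguishability_number e T"
    by (rule distinguishability_number_ge_unitary[OF e T uv])
  then show ?thesis by (simp add: numeral_eq_enat)
qed

text \<open>The vectors r (1, 0, \<plusminus>1, 0) and r (0, 1, 0, \<plusminus>1) form an
  orthonormal basis of \<real>^4 whose members all satisfy |u|^2 = |v|^2 = 1/2.\<close>

lemma four_channels:
  fixes T :: "real^2^2"
  assumes e: "orthonormal_basis e" and T: "T = vector [vector [1/2, 1/2], vector [1/2, 1/2]]"
  shows "4 \<le> distinguishability_number e T"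
proof -
  define r where "r = 1 / sqrt (2 :: real)"
  have r: "r\<^sup>2 = 1/2" by (simp add: r_def power_divide)
  define u where "u m = (if m < 2 then Complex r 0 else Complex 0 r)" for m :: nat
  define v where "v m = (if even m then u m else - u m)" for m
  have "enat 4 \<le> distinguishability_number e T"
  proof (rule distinguishability_number_ge_unitary[OF e, of _ "1/2" _ u v])
    fix m m' :: nat assume "m < 4" "m' < 4" "m \<noteq> m'"
    moreover from this have "m \<in> {0, 1, 2, 3}" "m' \<in> {0, 1, 2, 3}" by auto
    ultimately show "Re (cnj (u m) * u m' + cnj (v m) * v m') = 0"
      by (auto simp: u_def v_def)
  qed (simp_all add: T u_def v_def cmod_power2 r)
  then show ?thesis by (simp add: numeral_eq_enat)
qed

section \<open>Matching the bounds in the three cases\<close>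

theorem proposition26:
  fixes a b :: real and e :: "2 \<Rightarrow> complex^2" and T :: "real^2^2"
  assumes "orthonormal_basis e"
    and "0 \<le> a" "a \<le> 1" "0 \<le> b" "b \<le> 1"
    and "T = vector [vector [a, 1 - b], vector [1 - a, b]]"
  shows "(0 < \<bar>a - b\<bar> \<and> \<bar>a - b\<bar> \<le> 1/2 \<longrightarrow> distinguishability_number e T = 2) \<and>
         (a = b \<and> a \<in> {1/3..2/3} - {1/2} \<longrightarrow> distinguishability_number e T = 3) \<and>
         (a = b \<and> a = 1/2 \<longrightarrow> distinguishability_number e T = 4)"
proof (intro conjI impI)
  have le4: "card F \<le> 4" if "discriminated_channels F \<Psi>" for F :: "(complex^2^2 \<Rightarrow> complex^2^2) set" and \<Psi>
    using discriminated_channels.card_le[OF that] by simp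
  {
    assume ab: "0 < \<bar>a - b\<bar> \<and> \<bar>a - b\<bar> \<le> 1/2"
    have "distinguishability_number e T \<le> enat 2"
    proof (rule distinguishability_number_le)
      fix F \<Psi> assume "discriminated_channels F \<Psi>"
        and action: "\<And>\<Phi>. \<Phi> \<in> F \<Longrightarrow> has_classical_action e \<Phi> T"
      then interpret discriminated_channels F \<Psi> by simp
      show "card F \<le> 2"
      proof (rule ccontr)
        assume "\<not> card F \<le> 2"
        \<comment> \<open>The first row sums to 1 + a - b, so three channels would force a =
          b.\<close>
        then have "(\<Sum>l\<in>UNIV. T $ 1 $ l) = 1"
          by (intro row_sum_eq_1[OF assms(1) action]) simp_all
        then show False
          using ab by (simp add: assms(6) sum_2)
      qed
    qed
    moreover have "2 \<le> distinguishability_number e T"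
      using two_channels assms ab by blast
    ultimately show "distinguishability_number e T = 2"
      by (simp add: numeral_eq_enat)
  next
    assume ab: "a = b \<and> a \<in> {1/3..2/3} - {1/2}"
    have "distinguishability_number e T \<le> enat 3"
    proof (rule distinguishability_number_le)
      fix F \<Psi> assume F: "discriminated_channels F \<Psi>"
        and action: "\<And>\<Phi>. \<Phi> \<in> F \<Longrightarrow> has_classical_action e \<Phi> T"
      then interpret discriminated_channels F \<Psi> by simp
      have "card F \<noteq> 4"
      proof
        assume "card F = 4"
        then have "T $ 1 $ 1 = 1 / CARD(2)"
          by (intro maximal_classical_action[OF assms(1) action]) simp_all
        then show False
          using ab by (simp add: assms(6))
      qed
      then show "card F \<le> 3"
        using le4[OF F] by simp
    qed
    moreover have "3 \<le> distinguishability_number e T"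
      using ab by (intro three_channels[of e a]) (simp_all add: assms)
    ultimately show "distinguishability_number e T = 3"
      by (simp add: numeral_eq_enat)
  next
    assume ab: "a = b \<and> a = 1/2"
    have "distinguishability_number e T \<le> enat 4"
      by (rule distinguishability_number_le) (rule le4)
    moreover have "a = 1/2" "b = 1/2"
      using ab by auto
    then have "T = vector [vector [1/2, 1/2], vector [1/2, 1/2]]"
      by (simp only: assms(6)) simp
    then have "4 \<le> distinguishability_number e T"
      by (rule four_channels[OF assms(1)])
    ultimately show "distinguishability_number e T = 4"
      by (simp add: numeral_eq_enat)
  }
qed

end
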